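(* There are no red $K_5$'s in $\mathrm{Exoo}(42)$.
   Context: $\mathrm{Cyclic}(43)$ is the red/blue edge colouring of the complete graph $K_{43}$ on vertices $0,1,\dots,42$ (labels read modulo $43$) defined as follows. For distinct vertices $a,b$, the distance $\mathrm{d}(a,b)$ is the unique $m\in\{1,\dots,21\}$ with $a-b\equiv m$ or $b-a\equiv m \pmod{43}$. The edge between $a$ and $b$ is red if $\mathrm{d}(a,b)\in\{1,2,7,10,12,13,14,16,18,20,21\}$ and blue if $\mathrm{d}(a,b)\in\{3,4,5,6,8,9,11,15,17,19\}$. Write $\mathrm{e}(u,v)$ for the edge between $u$ and $v$. $\mathrm{Exoo}(42)$ is the coloured complete graph on the vertices $1,\dots,42$ obtained from $\mathrm{Cyclic}(43)$ by deleting vertex $0$ (and all edges at it) and changing the colour, from red to blue, of the following sixteen edges: $\mathrm{e}(11,32)$ and $\mathrm{e}(a,a+1)$ for $a\in\{4,5,6,7,13,14,15,16,23,24,30,33,39,40,41\}$. A red $K_5$ is a set of five distinct vertices all ten of whose edges are red. *)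

theory Defs
  imports "HOL-Number_Theory.Cong"
begin

datatype colour = Red | Blue

text \<open>
  A coloured complete graph is given by its vertex set and a colouring of its edges, where
  \<open>colouring u v\<close> is the colour of the edge between the distinct vertices \<open>u\<close> and \<open>v\<close>
  (so the colourings below are symmetric); the values \<open>colouring u u\<close> carry no meaning.
\<close>

record coloured_graph =
  vertices :: "int set"
  colouring :: "int \<Rightarrow> int \<Rightarrow> colour"

text \<open>The description is unique only if \<open>a\<close> and \<open>b\<close> are incongruent modulo 43; see
  \<open>distance_unique\<close> below.\<close>

definition distance :: "int \<Rightarrow> int \<Rightarrow> int" where
  "distance a b = (THE m. m \<in> {1..21} \<and> ([a - b = m] (mod 43) \<or> [b - a = m] (mod 43)))"

definition cyclic43 :: coloured_graph where
  "cyclic43 = \<lparr>vertices = {0..42},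
     colouring = (\<lambda>a b. if distance a b \<in> {1, 2, 7, 10, 12, 13, 14, 16, 18, 20, 21} then Red else Blue)\<rparr>"

definition recoloured_edges :: "int set set" where
  "recoloured_edges = insert {11, 32}
     ((\<lambda>a. {a, a + 1}) ` {4, 5, 6, 7, 13, 14, 15, 16, 23, 24, 30, 33, 39, 40, 41})"

definition exoo42 :: coloured_graph where
  "exoo42 = \<lparr>vertices = vertices cyclic43 - {0},
     colouring = (\<lambda>a b. if {a, b} \<in> recoloured_edges then Blue else colouring cyclic43 a b)\<rparr>"

definition red_K5 :: "coloured_graph \<Rightarrow> int set \<Rightarrow> bool" where
  "red_K5 G S \<longleftrightarrow> S \<subseteq> vertices G \<and> card S = 5 \<and>
     (\<forall>u\<in>S. \<forall>v\<in>S. u \<noteq> v \<longrightarrow> colouring G u v = Red)"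

lemma distance_unique:
  fixes a b :: int
  assumes "\<not> [a = b] (mod 43)"
  shows "\<exists>!m. m \<in> {1..21} \<and> ([a - b = m] (mod 43) \<or> [b - a = m] (mod 43))"
proof -
  define r where "r = (a - b) mod 43"
  have r: "1 \<le> r" "r \<le> 42"
    using assms pos_mod_bound[of "43 :: int" "a - b"] pos_mod_sign[of "43 :: int" "a - b"]
    unfolding r_def cong_iff_dvd_diff dvd_eq_mod_eq_0 by linarith+
  have s: "(b - a) mod 43 = 43 - r"
    using r zmod_zminus1_eq_if[of "a - b" 43] unfolding r_def by simp
  have *: "m \<in> {1..21} \<and> ([a - b = m] (mod 43) \<or> [b - a = m] (mod 43)) \<longleftrightarrow>
      m \<in> {1..21} \<and> (m = r \<or> m = 43 - r)" for m
  proof (cases "m \<in> {1..21}")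
    case True
    hence "m mod 43 = m" by simp
    thus ?thesis unfolding cong_def s r_def[symmetric] by auto
  qed blast
  show ?thesis
    unfolding * using r by (intro ex1I[of _ "min r (43 - r)"]) auto
qed

lemma distance_commute: "distance a b = distance b a"
  unfolding distance_def by (simp add: disj_commute)

lemma distance_eqI:
  assumes "m \<in> {1..21}" "[a - b = m] (mod 43) \<or> [b - a = m] (mod 43)"
  shows "distance a b = m"
proof -
  have "\<not> [a = b] (mod 43)"
  proof
    assume "[a = b] (mod 43)"
    hence "[a - b = 0] (mod 43)" "[b - a = 0] (mod 43)"
      by (simp_all add: cong_iff_dvd_diff dvd_diff_commute)
    with assms(2) have "[m = 0] (mod 43)"
      using cong_trans cong_sym by blast
    thus False
      using assms(1) by (auto simp: cong_def)
  qed
  from the1_equality[OF distance_unique[OF this]] show ?thesis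
    using assms unfolding distance_def by blast
qed

lemma colouring_cyclic43_commute: "colouring cyclic43 a b = colouring cyclic43 b a"
  by (simp add: cyclic43_def distance_commute)

lemma colouring_exoo42_commute: "colouring exoo42 a b = colouring exoo42 b a"
  by (simp add: exoo42_def insert_commute colouring_cyclic43_commute)

lemma card_recoloured_edges: "card recoloured_edges = 16"
  by (simp add: recoloured_edges_def doubleton_eq_iff)

lemma recoloured_edges_red:
  assumes "{a, b} \<in> recoloured_edges"
  shows "{a, b} \<subseteq> vertices exoo42" "colouring cyclic43 a b = Red"
proof -
  show "{a, b} \<subseteq> vertices exoo42"
    using assms by (auto simp: recoloured_edges_def exoo42_def cyclic43_def doubleton_eq_iff)
  have "\<bar>a - b\<bar> = 1 \<or> \<bar>a - b\<bar> = 21"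
    using assms by (auto simp: recoloured_edges_def doubleton_eq_iff)
  hence "distance a b = 1 \<or> distance a b = 21"
    by (smt (verit) atLeastAtMost_iff cong_refl distance_eqI)
  thus "colouring cyclic43 a b = Red"
    by (auto simp: cyclic43_def)
qed

end

theory Submission
  imports Defs
begin

text \<open>
  Recolouring only turns red edges blue, so a red \<open>K\<^sub>5\<close> of \<open>exoo42\<close> is a red \<open>K\<^sub>5\<close> of
  \<open>cyclic43\<close> that avoids the vertex 0 and contains none of the sixteen recoloured edges.
  The red graph of \<open>cyclic43\<close> is invariant under translation modulo 43, and its red \<open>K\<^sub>5\<close>'s
  form a single orbit: they are the 43 translates of \<open>{0, 1, 2, 22, 23}\<close>. To see this, translate
  the least vertex of a red \<open>K\<^sub>5\<close> to 0; the four others then lie among the 22 red neighbours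
  of 0, which leaves a small search (\<open>red_cliques_at_0\<close>).

  Each translate contains edges of length 1 and of length 21, and the recoloured edges, which have
  these lengths, are chosen so that every translate which misses 0 contains at least one of them
  (\<open>translate_meets_recoloured_edge\<close>).
\<close>

text \<open>
  The positive differences of the labels of two red-adjacent vertices: the red distances \<open>m\<close>
  together with \<open>43 - m\<close>. A list, so that the search below can be evaluated.
\<close>

definition red_gaps :: "int list" where
  "red_gaps = [1, 2, 7, 10, 12, 13, 14, 16, 18, 20, 21, 22, 23, 25, 27, 29, 30, 31, 33, 36, 41, 42]"

lemma sorted_red_gaps: "sorted_wrt (<) red_gaps"
  by (simp add: red_gaps_def)

lemma red_gap_if_red_cyclic43:
  assumes "a < b" "b - a < 43" "colouring cyclic43 a b = Red"
  shows "b - a \<in> set red_gaps"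
proof -
  define m where "m = (if b - a \<le> 21 then b - a else 43 - (b - a))"
  have "[a - b = 43 - (b - a)] (mod 43)"
    by (simp add: cong_iff_dvd_diff)
  hence "distance a b = m"
    using assms by (intro distance_eqI) (auto simp: m_def)
  hence "m \<in> {1, 2, 7, 10, 12, 13, 14, 16, 18, 20, 21}"
    using assms(3) by (simp add: cyclic43_def split: if_splits)
  hence "b - a \<in> {m, 43 - m}" "m \<in> {1, 2, 7, 10, 12, 13, 14, 16, 18, 20, 21}"
    by (auto simp: m_def)
  thus ?thesis
    unfolding red_gaps_def by auto
qed

text \<open>
  Backtracking: once \<open>v\<close> is chosen, only its neighbours later in the list remain candidates. Each
  clique is thus found once, with its vertices in the order of the candidate list.
\<close>

fun cliques :: "('a \<Rightarrow> 'a \<Rightarrow> bool) \<Rightarrow> nat \<Rightarrow> 'a list \<Rightarrow> 'a list list" where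
  "cliques adj 0 vs = [[]]"
| "cliques adj (Suc n) [] = []"
| "cliques adj (Suc n) (v # vs) =
     map ((#) v) (cliques adj n (filter (adj v) vs)) @ cliques adj (Suc n) vs"

text \<open>
  The search misses no increasing clique: either it starts with the least candidate \<open>v\<close>, and its
  other vertices survive the filter, or it avoids \<open>v\<close> altogether.
\<close>

lemma clique_in_cliques:
  fixes vs :: "'a :: linorder list"
  assumes "sorted_wrt (<) vs" "sorted_wrt (<) xs" "set xs \<subseteq> set vs" "sorted_wrt adj xs"
  shows "xs \<in> set (cliques adj (length xs) vs)"
  using assms
proof (induction adj "length xs" vs arbitrary: xs rule: cliques.induct)
  case (3 adj n v vs)
  from \<open>Suc n = length xs\<close> obtain x ys where xs: "xs = x # ys"
    by (cases xs) auto
  show ?case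
  proof (cases "x = v")
    case True
    have "ys \<in> set (cliques adj (length ys) (filter (adj v) vs))"
      using 3 xs True by (intro "3.hyps"(1)) (auto simp: sorted_wrt_filter)
    thus ?thesis
      using xs True by simp
  next
    case False
    \<comment> \<open>All of \<open>xs\<close> lies above \<open>x\<close>, which lies above the least element \<open>v\<close>.\<close>
    hence "set xs \<subseteq> set vs"
      using "3.prems" xs by fastforce
    hence "xs \<in> set (cliques adj (length xs) vs)"
      using "3.prems" "3.hyps"(3) by (intro "3.hyps"(2)) auto
    thus ?thesis
      using xs by simp
  qed
qed auto

text \<open>
  The red \<open>K\<^sub>4\<close>'s in the neighbourhood of 0. There are five of them because each of the five
  vertices of \<open>{0, 1, 2, 22, 23}\<close> can be the one that is translated to 0.
\<close>

lemma red_cliques_at_0: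
  "cliques (\<lambda>u v. v - u \<in> set red_gaps) 4 red_gaps =
     [[1, 2, 22, 23], [1, 21, 22, 23], [1, 21, 22, 42], [20, 21, 22, 42], [20, 21, 41, 42]]"
  by code_simp

text \<open>
  Subtracting the least vertex keeps all labels nonnegative, so differences of labels can be used
  directly and no reduction modulo 43 is needed.
\<close>

lemma red_K5_gaps:
  assumes gaps: "\<And>u v. u \<in> {a, b, c, d, e} \<Longrightarrow> v \<in> {a, b, c, d, e} \<Longrightarrow> u < v \<Longrightarrow> v - u \<in> set red_gaps"
    and sorted: "a < b" "b < c" "c < d" "d < e"
  shows "(b - a, c - a, d - a, e - a) \<in> {(1, 2, 22, 23), (1, 21, 22, 23),
    (1, 21, 22, 42), (20, 21, 22, 42), (20, 21, 41, 42)}"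
proof -
  have "b - a \<in> set red_gaps" "c - a \<in> set red_gaps" "d - a \<in> set red_gaps"
    "e - a \<in> set red_gaps" "c - b \<in> set red_gaps" "d - b \<in> set red_gaps"
    "e - b \<in> set red_gaps" "d - c \<in> set red_gaps" "e - c \<in> set red_gaps" "e - d \<in> set red_gaps"
    using sorted by (auto intro!: gaps)
  hence "[b - a, c - a, d - a, e - a] \<in> set (cliques (\<lambda>u v. v - u \<in> set red_gaps) 4 red_gaps)"
    using sorted clique_in_cliques[of red_gaps "[b - a, c - a, d - a, e - a]"
        "\<lambda>u v. v - u \<in> set red_gaps"]
    by (simp add: sorted_red_gaps numeral_eq_Suc)
  thus ?thesis
    unfolding red_cliques_at_0 by simp
qed

text \<open>
  Within the labels 1 to 42, a translate of \<open>{0, 1, 2, 22, 23}\<close> has one of two shapes, according to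
  whether or not two of its labels wrap around past 42: \<open>{a, a+1, a+2, a+22, a+23}\<close>, or
  \<open>{a, a+1, a+21, a+22, a+23}\<close>. Most are hit by an edge \<open>{i, i + 1}\<close>; the only ones that need
  \<open>{11, 32}\<close> are the first shape with \<open>a = 9, 10\<close> and the second with \<open>a = 10\<close>.
\<close>

lemma translate_meets_recoloured_edge:
  fixes a :: int
  assumes "1 \<le> a" "a \<le> 19" "{a, a + 1, a + 2, a + 22, a + 23} \<subseteq> S \<or>
    {a, a + 1, a + 21, a + 22, a + 23} \<subseteq> S"
  shows "\<exists>u\<in>S. \<exists>v\<in>S. u < v \<and> {u, v} \<in> recoloured_edges"
proof (rule ccontr)
  assume no: "\<not> ?thesis"
  define A :: "int set" where "A = {4, 5, 6, 7, 13, 14, 15, 16, 23, 24, 30, 33, 39, 40, 41}"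
  have short: "i \<notin> A" if "i \<in> S" "j \<in> S" "j = i + 1" for i j
  proof
    assume "i \<in> A"
    hence "{i, i + 1} \<in> recoloured_edges"
      unfolding recoloured_edges_def A_def by blast
    thus False using no that by force
  qed
  have long: "\<not> (11 \<in> S \<and> 32 \<in> S)"
  proof
    assume "11 \<in> S \<and> 32 \<in> S"
    moreover have "{11, 32} \<in> recoloured_edges"
      unfolding recoloured_edges_def by (rule insertI1)
    moreover have "(11 :: int) < 32"
      by simp
    ultimately show False
      using no by blast
  qed
  have common: "a \<in> S" "a + 1 \<in> S" "a + 22 \<in> S" "a + 23 \<in> S"
    using assms(3) by auto
  have "a \<notin> A" "a + 22 \<notin> A"
    by (rule short[OF common(1,2)], simp) (rule short[OF common(3,4)], simp)
  moreover have "a \<in> {1..19}"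
    using assms by simp
  hence "a = 1 \<or> a = 2 \<or> a = 3 \<or> a = 4 \<or> a = 5 \<or> a = 6 \<or> a = 7 \<or> a = 8 \<or> a = 9 \<or> a = 10 \<or>
      a = 11 \<or> a = 12 \<or> a = 13 \<or> a = 14 \<or> a = 15 \<or> a = 16 \<or> a = 17 \<or> a = 18 \<or> a = 19"
    by simp presburger
  \<comment> \<open>The two edges of the form \<open>{i, i + 1}\<close> at fixed places in both shapes leave four cases.\<close>
  ultimately have exceptions: "a = 3 \<or> a = 9 \<or> a = 10 \<or> a = 12"
    unfolding A_def by (elim disjE) simp_all
  from assms(3) show False
  proof
    assume "{a, a + 1, a + 2, a + 22, a + 23} \<subseteq> S"
    hence S: "a + 1 \<in> S" "a + 2 \<in> S" "a + 22 \<in> S" "a + 23 \<in> S"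
      by simp_all
    have "a + 1 \<notin> A"
      by (rule short[OF S(1,2)]) simp
    thus False
      using exceptions S long unfolding A_def by (elim disjE) simp_all
  next
    assume "{a, a + 1, a + 21, a + 22, a + 23} \<subseteq> S"
    hence S: "a + 1 \<in> S" "a + 21 \<in> S" "a + 22 \<in> S"
      by simp_all
    have "a + 21 \<notin> A"
      by (rule short[OF S(2,3)]) simp
    thus False
      using exceptions S long unfolding A_def by (elim disjE) simp_all
  qed
qed

theorem theorem3p1: "\<not> (\<exists>S. red_K5 exoo42 S)"
proof
  assume "\<exists>S. red_K5 exoo42 S"
  then obtain S where S: "red_K5 exoo42 S" ..
  have range: "v \<in> {1..42}" if "v \<in> S" for v
    using S that by (force simp: red_K5_def exoo42_def cyclic43_def)
  have red: "{u, v} \<notin> recoloured_edges" "v - u \<in> set red_gaps"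
    if "u \<in> S" "v \<in> S" "u < v" for u v
  proof -
    have "colouring exoo42 u v = Red"
      using S that by (auto simp: red_K5_def)
    thus "{u, v} \<notin> recoloured_edges" "v - u \<in> set red_gaps"
      using that range[of u] range[of v] red_gap_if_red_cyclic43[of u v]
      by (auto simp: exoo42_def split: if_splits)
  qed
  have card: "card S = 5"
    using S by (simp add: red_K5_def)
  hence "finite S"
    by (simp add: card_ge_0_finite)
  moreover from card have "length (sorted_list_of_set S) = 5"
    by simp
  then obtain a b c d e where list: "sorted_list_of_set S = [a, b, c, d, e]"
    by (auto simp del: length_sorted_list_of_set simp: numeral_eq_Suc length_Suc_conv)
  ultimately have S_eq: "S = {a, b, c, d, e}"
    using set_sorted_list_of_set[of S] by simp
  have sorted: "a < b" "b < c" "c < d" "d < e"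
    using strict_sorted_list_of_set[of S] by (simp_all add: list)
  have "(b - a, c - a, d - a, e - a) \<in> {(1, 2, 22, 23), (1, 21, 22, 23),
      (1, 21, 22, 42), (20, 21, 22, 42), (20, 21, 41, 42)}"
    using red(2) sorted unfolding S_eq by (intro red_K5_gaps) auto
  \<comment> \<open>A difference of 42 would need the vertex 0, which leaves the first two cases.\<close>
  moreover have "1 \<le> a" "e \<le> 42"
    using range S_eq by auto
  ultimately have "e = a + 23" "d = a + 22" "b = a + 1" "c = a + 2 \<or> c = a + 21"
    by auto
  hence "\<exists>u\<in>S. \<exists>v\<in>S. u < v \<and> {u, v} \<in> recoloured_edges"
    using \<open>1 \<le> a\<close> \<open>e \<le> 42\<close> by (intro translate_meets_recoloured_edge[of a]) (auto simp: S_eq)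
  thus False
    using red(1) by blast
qed

end
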